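(* For every integer $N>2$, there exists a complex-valued signal $x$ with support $\{0,\dots,N-1\}$ such that $x$ cannot be uniquely recovered from $|\widehat x|$ and $\arg x=(\arg x[n])_{n=0}^{N-1}$.
   Context: A (discrete-time) signal is a sequence $x=(x[n])_{n\in\mathbb Z}$ of complex numbers. It has support $\{0,\dots,N-1\}$ if $x[n]=0$ for $n\notin\{0,\dots,N-1\}$ and $x[0]\neq0$, $x[N-1]\ne 0$. Its Fourier transform is $\widehat x(\omega)=\sum_{n\in\mathbb Z}x[n]e^{-i\omega n}$, $\omega\in\mathbb R$, and $|\widehat x|$ is the function $\omega\mapsto|\widehat x(\omega)|$. Phases are understood modulo $2\pi$; the phase of $0$ is not uniquely defined, and the condition $\arg z=\arg w$ counts as satisfied whenever $z=0$ or $w=0$. "$x$ can be uniquely recovered from $|\widehat x|$ and $\arg x$" means that the only signal $y$ with support $\{0,\dots,N-1\}$ satisfying $|\widehat y(\omega)|=|\widehat x(\omega)|$ for all $\omega\in\mathbb R$ and $\arg y[n]=\arg x[n]$ for all $n\in\{0,\dots,N-1\}$ is $y=x$. *)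

theory Defs
  imports "HOL-Analysis.Analysis"
begin

type_synonym signal = "int \<Rightarrow> complex"

definition has_support :: "signal \<Rightarrow> nat \<Rightarrow> bool" where
  "has_support x N \<longleftrightarrow>
     (\<forall>n. n \<notin> {0..int N - 1} \<longrightarrow> x n = 0) \<and> x 0 \<noteq> 0 \<and> x (int N - 1) \<noteq> 0"

definition fourier :: "signal \<Rightarrow> real \<Rightarrow> complex" where
  "fourier x \<omega> = (\<Sum>\<^sub>\<infinity>n\<in>UNIV. x n * exp (- (\<i> * of_real \<omega> * of_int n)))"

text \<open>For nonzero arguments, \<open>Arg\<close> is the principal value of the phase, in (-pi, pi], so its
  equality is equality of phases modulo 2 * pi. The phase of 0 is compatible with every phase.\<close>
definition same_phase :: "complex \<Rightarrow> complex \<Rightarrow> bool" where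
  "same_phase z w \<longleftrightarrow> z = 0 \<or> w = 0 \<or> Arg z = Arg w"

text \<open>Only meaningful for signals \<open>x\<close> with \<open>has_support x N\<close>; such an \<open>x\<close> is itself one of
  the signals \<open>y\<close> considered.\<close>
definition uniquely_recoverable :: "signal \<Rightarrow> nat \<Rightarrow> bool" where
  "uniquely_recoverable x N \<longleftrightarrow>
     (\<forall>y. has_support y N
          \<and> (\<forall>\<omega>. cmod (fourier y \<omega>) = cmod (fourier x \<omega>))
          \<and> (\<forall>n\<in>{0..int N - 1}. same_phase (y n) (x n))
        \<longrightarrow> y = x)"

end

theory Submission
  imports Defs
begin

text \<open>The Fourier modulus cannot distinguish a signal from its conjugate reflection
  \<open>n \<mapsto> cnj (x (c - n))\<close>: the two transforms are conjugate up to a unimodular factor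
  (\<open>fourier_conjugate_reflection\<close>). With \<open>c = N - 1\<close> the reflection also preserves the support
  \<open>{0..N - 1}\<close>. The reflection has the phases of \<open>x\<close> as soon as
  \<open>x n\<close> and \<open>cnj (x (N - 1 - n))\<close> always have the same phase, in particular when all
  entries are positive reals, and it differs from \<open>x\<close> as soon as \<open>x\<close> is not a
  palindrome. The ramp \<open>1, 2, \<dots>, N\<close> has both properties, and it has no zero entry on its
  support, so the ambiguity does not rest on the phase convention for \<open>0\<close>.\<close>

text \<open>Substituting \<open>c - n\<close> for \<open>n\<close> turns \<open>exp (- \<i> \<omega> n)\<close> into
  \<open>exp (- \<i> \<omega> c) * cnj (exp (- \<i> \<omega> n))\<close>. Reindexing and conjugation
  commute with \<open>infsum\<close> for divergent series as well, since their sum is \<open>0\<close> by default.\<close>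
lemma fourier_conjugate_reflection:
  fixes x :: signal and c :: int
  shows "fourier (\<lambda>n. cnj (x (c - n))) \<omega> =
           exp (- (\<i> * of_real \<omega> * of_int c)) * cnj (fourier x \<omega>)"
proof -
  let ?e = "\<lambda>n::int. exp (- (\<i> * of_real \<omega> * of_int n))"
  have e: "?e (c - n) = ?e c * cnj (?e n)" for n
    by (simp add: exp_cnj flip: exp_add) (simp add: algebra_simps)
  have bij: "bij_betw (\<lambda>n. c - n) UNIV (UNIV :: int set)"
    by (rule bij_betwI[where g = "\<lambda>n. c - n"]) auto
  have "fourier (\<lambda>n. cnj (x (c - n))) \<omega> =
          (\<Sum>\<^sub>\<infinity>n\<in>UNIV. cnj (x (c - n)) * ?e n)"
    by (simp add: fourier_def)
  also have "\<dots> = (\<Sum>\<^sub>\<infinity>n\<in>UNIV. cnj (x n) * ?e (c - n))"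
    using infsum_reindex_bij_betw[OF bij, of "\<lambda>n. cnj (x (c - n)) * ?e n"] by simp
  also have "\<dots> = (\<Sum>\<^sub>\<infinity>n\<in>UNIV. ?e c * cnj (x n * ?e n))"
    unfolding e by (simp only: complex_cnj_mult mult_ac)
  also have "\<dots> = ?e c * cnj (fourier x \<omega>)"
    unfolding fourier_def by (simp only: infsum_cmult_right' infsum_cnj)
  finally show ?thesis .
qed

corollary cmod_fourier_conjugate_reflection:
  "cmod (fourier (\<lambda>n. cnj (x (c - n))) \<omega>) = cmod (fourier x \<omega>)"
  by (simp add: fourier_conjugate_reflection norm_mult)

lemma has_support_conjugate_reflection:
  assumes "has_support x N"
  shows "has_support (\<lambda>n. cnj (x (int N - 1 - n))) N"
  using assms by (auto simp: has_support_def)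

theorem theorem4p9:
  fixes N :: nat
  assumes "N > 2"
  shows "\<exists>x. has_support x N \<and> \<not> uniquely_recoverable x N"
proof -
  define x :: signal where "x n = (if n \<in> {0..int N - 1} then of_int (n + 1) else 0)" for n
  define y :: signal where "y n = cnj (x (int N - 1 - n))" for n
  have supp_x: "has_support x N"
    using assms by (auto simp: has_support_def x_def)
  have supp_y: "has_support y N"
    using has_support_conjugate_reflection[OF supp_x] by (simp add: y_def[abs_def])
  have modulus: "cmod (fourier y \<omega>) = cmod (fourier x \<omega>)" for \<omega>
    by (simp add: y_def[abs_def] cmod_fourier_conjugate_reflection)
  have phase: "same_phase (y n) (x n)" if n: "n \<in> {0..int N - 1}" for n
  proof -
    have "x n = of_real (of_int (n + 1))" and "y n = of_real (of_int (int N - n))"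
      using n by (auto simp: x_def y_def)
    moreover have "Arg (of_real (of_int (n + 1))) = 0" "Arg (of_real (of_int (int N - n))) = 0"
      using n by (simp_all only: Arg_of_real) auto
    ultimately show ?thesis
      by (simp only: same_phase_def simp_thms)
  qed
  have "y 0 = of_nat N" and "x 0 = 1"
    using assms by (auto simp: x_def y_def)
  then have "y \<noteq> x"
    using assms by auto
  with supp_x supp_y modulus phase show ?thesis
    unfolding uniquely_recoverable_def by blast
qed

end
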